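(* Let $\Bbbk$ be a field and $m\ge 0$ an integer. For any double cosets $\mathfrak a,\mathfrak p\in\mathbf{P}\backslash \mathrm{GL}(\infty,\Bbbk)/\mathbf{P}$ one has $$(\mathfrak a\star\mathfrak p)^*=\mathfrak p^*\star\mathfrak a^*.$$
   Context: Let $\Bbbk$ be a field and $m\ge 0$ an integer. Matrices are indexed by the set $I=L\sqcup C\sqcup R$, where $L=\{l_1,l_2,\dots\}$, $C=\{c_1,\dots,c_m\}$, $R=\{r_1,r_2,\dots\}$, ordered as $\dots,l_2,l_1,c_1,\dots,c_m,r_1,r_2,\dots$ (so matrices are infinite to the left, right, up and down, and are regarded as block matrices of size $\infty+m+\infty$). $\mathrm{GL}(\infty,\Bbbk)$ is the group of invertible $I\times I$ matrices $g$ over $\Bbbk$ that are finitary, i.e. $g-1$ has only finitely many nonzero entries. $\mathbf{P}\subset \mathrm{GL}(\infty,\Bbbk)$ is the subgroup of matrices which, in block form with respect to $I=L\sqcup C\sqcup R$, look like $$\begin{pmatrix}\alpha&\varphi&\theta\\ 0&\mathbf 1_m&\psi\\ 0&0&\beta\end{pmatrix},$$ where $\mathbf 1_m$ is the unit matrix of order $m$. $\mathbf{P}\backslash \mathrm{GL}(\infty,\Bbbk)/\mathbf{P}$ denotes the set of double cosets $\mathbf{P}g\mathbf{P}$. For an integer $N\ge 0$, an element $g\in \mathrm{GL}(\infty,\Bbbk)$ is called $N$-supported if $(g-1)_{ij}\neq 0$ implies that both $i$ and $j$ lie in $\{l_1,\dots,l_N\}\cup C\cup\{r_1,\dots,r_N\}$.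 Every element is $N$-supported for all sufficiently large $N$. $J_N\in \mathrm{GL}(\infty,\Bbbk)$ is the permutation matrix of the involution of $I$ that swaps $l_i\leftrightarrow l_{i+N}$ and $r_i\leftrightarrow r_{i+N}$ for $1\le i\le N$ and fixes all other indices. The $\star$-product of the double cosets $\mathbf{P}a\mathbf{P}$ and $\mathbf{P}p\mathbf{P}$ is the double coset $\mathbf{P}\,(a\,J_N\,p\,J_N)\,\mathbf{P}$, where $N$ is any integer such that the representatives $a$ and $p$ are both $N$-supported; this double coset does not depend on the choice of representatives or of $N$. The involution $*$ on $\mathbf{P}\backslash \mathrm{GL}(\infty,\Bbbk)/\mathbf{P}$ is $(\mathbf{P}a\mathbf{P})^*:=\mathbf{P}a^{-1}\mathbf{P}$, where $a^{-1}$ is the inverse matrix; it is well defined because $\mathbf P$ is a group. *)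

theory Defs
  imports "HOL-Algebra.Coset" "HOL-Library.Groups_Big_Fun"
begin

text \<open>
  The index set is a subset of a type, as it depends on the natural number \<open>m\<close>
  (which may be \<open>0\<close>): \<open>IL i\<close>, \<open>IC i\<close>, \<open>IR i\<close> stand for \<open>l_i\<close>, \<open>c_i\<close>, \<open>r_i\<close>,
  numbered from 1. A matrix over the index set is a function of two indices that
  vanishes outside it.
\<close>

datatype idx = IL nat | IC nat | IR nat

type_synonym 'k imat = "idx \<Rightarrow> idx \<Rightarrow> 'k"

definition index_set :: "nat \<Rightarrow> idx set" where
  "index_set m = IL ` {1..} \<union> IC ` {1..m} \<union> IR ` {1..}"

definition window :: "nat \<Rightarrow> nat \<Rightarrow> idx set" where
  "window m N = IL ` {1..N} \<union> IC ` {1..m} \<union> IR ` {1..N}"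

definition is_imat :: "nat \<Rightarrow> 'k::field imat \<Rightarrow> bool" where
  "is_imat m g \<longleftrightarrow> (\<forall>i j. g i j \<noteq> 0 \<longrightarrow> i \<in> index_set m \<and> j \<in> index_set m)"

definition imat_one :: "nat \<Rightarrow> 'k::field imat" where
  "imat_one m = (\<lambda>i j. if i = j \<and> i \<in> index_set m then 1 else 0)"

text \<open>
  \<^const>\<open>Sum_any\<close> is the sum over all indices with nonzero summand. There are only finitely
  many of these for each entry as soon as one of the two factors is finitary, because
  rows and columns of finitary matrices have finite support.
\<close>

definition imat_mult :: "'k::field imat \<Rightarrow> 'k imat \<Rightarrow> 'k imat" where
  "imat_mult a b = (\<lambda>i j. Sum_any (\<lambda>k. a i k * b k j))"

definition finitary :: "nat \<Rightarrow> 'k::field imat \<Rightarrow> bool" where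
  "finitary m g \<longleftrightarrow> finite {(i, j). g i j - imat_one m i j \<noteq> 0}"

definition imat_invertible :: "nat \<Rightarrow> 'k::field imat \<Rightarrow> bool" where
  "imat_invertible m g \<longleftrightarrow>
     (\<exists>h. is_imat m h \<and> imat_mult g h = imat_one m \<and> imat_mult h g = imat_one m)"

definition GL :: "nat \<Rightarrow> 'k::field imat monoid" where
  "GL m = \<lparr>carrier = {g. is_imat m g \<and> imat_invertible m g \<and> finitary m g},
           mult = imat_mult, one = imat_one m\<rparr>"

definition P :: "nat \<Rightarrow> 'k::field imat set" where
  "P m = {g \<in> carrier (GL m).
     (\<forall>i j. g (IC i) (IL j) = 0) \<and>
     (\<forall>i j. g (IR i) (IL j) = 0) \<and>
     (\<forall>i j. g (IR i) (IC j) = 0) \<and>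
     (\<forall>i\<in>{1..m}. \<forall>j\<in>{1..m}. g (IC i) (IC j) = (if i = j then 1 else 0))}"

definition dcoset :: "nat \<Rightarrow> 'k::field imat \<Rightarrow> 'k imat set" where
  "dcoset m g = (P m #>\<^bsub>GL m\<^esub> g) <#>\<^bsub>GL m\<^esub> P m"

definition double_cosets :: "nat \<Rightarrow> 'k::field imat set set" where
  "double_cosets m = dcoset m ` carrier (GL m)"

definition supported :: "nat \<Rightarrow> nat \<Rightarrow> 'k::field imat \<Rightarrow> bool" where
  "supported m N g \<longleftrightarrow>
     (\<forall>i j. g i j - imat_one m i j \<noteq> 0 \<longrightarrow> i \<in> window m N \<and> j \<in> window m N)"

definition shift_swap :: "nat \<Rightarrow> nat \<Rightarrow> nat" where
  "shift_swap N i =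
     (if i \<in> {1..N} then i + N else if i \<in> {N + 1..2 * N} then i - N else i)"

fun idx_swap :: "nat \<Rightarrow> idx \<Rightarrow> idx" where
  "idx_swap N (IL i) = IL (shift_swap N i)"
| "idx_swap N (IC i) = IC i"
| "idx_swap N (IR i) = IR (shift_swap N i)"

definition J :: "nat \<Rightarrow> nat \<Rightarrow> 'k::field imat" where
  "J m N = (\<lambda>i j. if i = idx_swap N j \<and> j \<in> index_set m then 1 else 0)"

text \<open>
  Both operations are given on representatives; \<open>THE\<close> singles out the double coset that
  all admissible choices (of representatives and of \<open>N\<close>) have in common.
\<close>

definition star :: "nat \<Rightarrow> 'k::field imat set \<Rightarrow> 'k imat set \<Rightarrow> 'k imat set" where
  "star m A B = (THE D. \<exists>a\<in>A. \<exists>p\<in>B. \<exists>N. supported m N a \<and> supported m N p \<and>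
     D = dcoset m (a \<otimes>\<^bsub>GL m\<^esub> J m N \<otimes>\<^bsub>GL m\<^esub> p \<otimes>\<^bsub>GL m\<^esub> J m N))"

definition involution :: "nat \<Rightarrow> 'k::field imat set \<Rightarrow> 'k imat set" where
  "involution m A = (THE D. \<exists>a\<in>A. D = dcoset m (inv\<^bsub>GL m\<^esub> a))"

end

(*
  P consists of the g in GL for which g - 1 is supported on the rows in L and the columns in R.
  Let N be large and y in P be N-supported. Conjugating y by the shift J g J of an N-supported g
  gives an element of P again, because J g J fixes the basis vectors of L and R in the window
  of y. Hence in (x a y) J (z p w) J the factors y and z can be moved out, and the star product
  is well defined; its independence of N follows from conjugation with a permutation matrix in P
  that commutes with a. Finally (a J p J)^-1 = J (p^-1 J a^-1 J) J, and J lies in P.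
*)

theory Submission
  imports Defs "Jordan_Normal_Form.Determinant"
begin

text \<open>Two facts that are formal for finite matrices fail for infinite ones:
  \<open>imat_mult\<close> is not associative on arbitrary matrices, and an invertible block
  triangular matrix may have an inverse that is not block triangular. A matrix supported in a
  window, however, multiplies like a finite matrix on that window, extended by the unit matrix.
  Computations with products therefore put the matrices involved into one common window, and the
  closure of P under inverses rests on a finite square block. The shift leaves C as the only part of
  the window where both \<open>g\<close> and its shifted copy can act nontrivially. The unit block
  of P on C is what makes the conjugation argument work: y - 1 has no entries there, so the shifted
  matrix never meets y - 1 in a block that has to stay trivial.\<close>

lemma finite_left_inverse_imp_right_inverse:
  fixes a b :: "'i \<Rightarrow> 'i \<Rightarrow> 'k::field"
  assumes "finite S"
    and ab: "\<And>i j. i \<in> S \<Longrightarrow> j \<in> S \<Longrightarrow> (\<Sum>k\<in>S. a i k * b k j) = (if i = j then 1 else 0)"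
    and "i \<in> S" "j \<in> S"
  shows "(\<Sum>k\<in>S. b i k * a k j) = (if i = j then 1 else 0)"
proof -
  define n where "n = card S"
  \<comment> \<open>Enumerating \<open>S\<close> transports the claim to \<open>n\<close> by
    \<open>n\<close> matrices, where a one-sided inverse over a field is two-sided.\<close>
  obtain f where f: "bij_betw f {0..<n} S"
    using ex_bij_betw_nat_finite[OF \<open>finite S\<close>] n_def by blast
  define A where "A = mat n n (\<lambda>(i, j). a (f i) (f j))"
  define B where "B = mat n n (\<lambda>(i, j). b (f i) (f j))"
  have inj: "f i = f j \<longleftrightarrow> i = j" if "i < n" "j < n" for i j
    using f that by (auto simp: bij_betw_def inj_on_def)
  have mem: "f i \<in> S" if "i < n" for i
    using f that by (auto simp: bij_betw_def)
  have carr: "A \<in> carrier_mat n n" "B \<in> carrier_mat n n"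
    by (auto simp: A_def B_def)
  have "A * B = 1\<^sub>m n"
    by (rule eq_matI)
      (auto simp: A_def B_def scalar_prod_def sum.reindex_bij_betw[OF f, of "\<lambda>k. a _ k * b k _"]
         ab mem inj)
  then have BA: "B * A = 1\<^sub>m n"
    using mat_mult_left_right_inverse carr by blast
  obtain i' j' where ij: "i' < n" "j' < n" "i = f i'" "j = f j'"
    using f assms by (fastforce simp: bij_betw_def)
  have "(\<Sum>k\<in>S. b i k * a k j) = (B * A) $$ (i', j')"
    using ij by (simp add: A_def B_def scalar_prod_def
        sum.reindex_bij_betw[OF f, of "\<lambda>k. b _ k * a k _"])
  then show ?thesis
    using ij by (simp add: BA inj)
qed

section \<open>Finitary matrices as finite matrices on a window\<close>

lemma finite_window [simp]: "finite (window m N)"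
  by (simp add: window_def)

lemma window_subset: "window m N \<subseteq> index_set m"
  by (auto simp: window_def index_set_def)

lemma IL_in_window: "IL n \<in> window m N \<longleftrightarrow> n \<in> {1..N}"
  by (auto simp: window_def)

lemma IR_in_window: "IR n \<in> window m N \<longleftrightarrow> n \<in> {1..N}"
  by (auto simp: window_def)

lemma supported_entry: "supported m N a \<Longrightarrow> i \<notin> window m N \<or> j \<notin> window m N \<Longrightarrow> a i j = imat_one m i j"
  by (auto simp: supported_def)

lemma supportedI: "(\<And>i j. i \<notin> window m N \<or> j \<notin> window m N \<Longrightarrow> a i j = imat_one m i j) \<Longrightarrow> supported m N a"
  by (auto simp: supported_def)

lemma supported_mono: "supported m N a \<Longrightarrow> N \<le> M \<Longrightarrow> supported m M a"
  unfolding supported_def window_def by fastforce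

lemma supported_one: "supported m N (imat_one m)"
  by (simp add: supported_def)

text \<open>Outside the window the entries are those of the unit matrix, and the window lies in the
  index set. Hence \<open>supported\<close> can serve as the only hypothesis on a matrix.\<close>

lemma supported_is_imat:
  assumes "supported m N a"
  shows "is_imat m a"
  unfolding is_imat_def
proof (intro allI impI)
  fix i j
  assume "a i j \<noteq> 0"
  then show "i \<in> index_set m \<and> j \<in> index_set m"
    using supported_entry[OF assms, of i j] window_subset[of m N]
    by (cases "i \<in> window m N \<and> j \<in> window m N") (auto simp: imat_one_def split: if_splits)
qed

lemma supported_finitary: "supported m N a \<Longrightarrow> finitary m a"
  unfolding finitary_def supported_def
  by (rule finite_subset[of _ "window m N \<times> window m N"]) auto

lemma finite_subset_window:
  assumes "finite F" "F \<subseteq> index_set m"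
  shows "\<exists>N. F \<subseteq> window m N"
  using assms
proof (induction rule: finite_induct)
  case (insert x F)
  then obtain N where N: "F \<subseteq> window m N" by auto
  have mono: "window m N \<subseteq> window m (N + k)" for k
    by (auto simp: window_def)
  show ?case
  proof (cases x)
    case (IL n)
    then have "x \<in> window m (N + n)" using insert.prems by (auto simp: window_def index_set_def)
    then show ?thesis using N mono by blast
  next
    case (IC n)
    then have "x \<in> window m N" using insert.prems by (auto simp: window_def index_set_def)
    then show ?thesis using N by blast
  next
    case (IR n)
    then have "x \<in> window m (N + n)" using insert.prems by (auto simp: window_def index_set_def)
    then show ?thesis using N mono by blast
  qed
qed auto

lemma finitary_supported:
  assumes "is_imat m a" "finitary m a"
  shows "\<exists>N. supported m N a"
proof -
  let ?D = "{(i, j). a i j - imat_one m i j \<noteq> 0}"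
  have sub: "fst ` ?D \<union> snd ` ?D \<subseteq> index_set m"
    using assms(1) unfolding is_imat_def imat_one_def by (fastforce split: if_splits)
  have "finite (fst ` ?D \<union> snd ` ?D)"
    using assms(2) by (simp add: finitary_def)
  from finite_subset_window[OF this sub] obtain N where "fst ` ?D \<union> snd ` ?D \<subseteq> window m N" ..
  then have "supported m N a"
    unfolding supported_def by force
  then show ?thesis ..
qed

text \<open>Asking only for row \<open>i\<close> to be a unit row covers the unit matrix and also
  every row outside the window of a supported matrix.\<close>

lemma imat_mult_one_row:
  assumes "\<And>k. a i k = imat_one m i k" "is_imat m b"
  shows "imat_mult a b i j = b i j"
proof -
  have "Sum_any (\<lambda>k. a i k * b k j) = (\<Sum>k\<in>{i}. a i k * b k j)"
    by (rule Sum_any.expand_superset) (auto simp: assms(1) imat_one_def)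
  then show ?thesis
    using assms by (auto simp: imat_mult_def imat_one_def is_imat_def)
qed

lemma imat_mult_one_col:
  assumes "\<And>k. b k j = imat_one m k j" "is_imat m a"
  shows "imat_mult a b i j = a i j"
proof -
  have "Sum_any (\<lambda>k. a i k * b k j) = (\<Sum>k\<in>{j}. a i k * b k j)"
    by (rule Sum_any.expand_superset) (auto simp: assms(1) imat_one_def split: if_splits)
  then show ?thesis
    using assms by (auto simp: imat_mult_def imat_one_def is_imat_def)
qed

lemma imat_mult_one_left: "is_imat m a \<Longrightarrow> imat_mult (imat_one m) a = a"
  by (intro ext imat_mult_one_row) auto

lemma imat_mult_one_right: "is_imat m a \<Longrightarrow> imat_mult a (imat_one m) = a"
  by (intro ext imat_mult_one_col) auto

text \<open>Replaces \<open>Sum_any\<close> by a sum over a fixed finite set: for \<open>i\<close>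
  in the window, row \<open>i\<close> of \<open>a\<close> vanishes outside it. Associativity is then
  an interchange of finite sums.\<close>

lemma imat_mult_entry:
  assumes a: "supported m N a" and b: "supported m N b"
  shows "imat_mult a b i j =
    (if i \<in> window m N \<and> j \<in> window m N then \<Sum>k\<in>window m N. a i k * b k j else imat_one m i j)"
proof -
  consider "i \<notin> window m N" | "j \<notin> window m N" | "i \<in> window m N" "j \<in> window m N" by blast
  then show ?thesis
  proof cases
    case 1
    then have "imat_mult a b i j = b i j"
      by (intro imat_mult_one_row[where m = m] supported_entry[OF a] supported_is_imat[OF b]) auto
    then show ?thesis using 1 supported_entry[OF b] by simp
  next
    case 2
    then have "imat_mult a b i j = a i j"
      by (intro imat_mult_one_col[where m = m] supported_entry[OF b] supported_is_imat[OF a]) auto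
    then show ?thesis using 2 supported_entry[OF a] by simp
  next
    case 3
    have "Sum_any (\<lambda>k. a i k * b k j) = (\<Sum>k\<in>window m N. a i k * b k j)"
    proof (rule Sum_any.expand_superset)
      show "{k. a i k * b k j \<noteq> 0} \<subseteq> window m N"
      proof
        fix k
        assume "k \<in> {k. a i k * b k j \<noteq> 0}"
        then show "k \<in> window m N"
          using 3 supported_entry[OF a, of i k] by (cases "i = k") (auto simp: imat_one_def)
      qed
    qed simp
    then show ?thesis using 3 by (simp add: imat_mult_def)
  qed
qed

lemma supported_mult:
  "supported m N a \<Longrightarrow> supported m N b \<Longrightarrow> supported m N (imat_mult a b)"
  by (rule supportedI) (auto simp: imat_mult_entry)

lemma imat_mult_assoc:
  assumes "supported m N a" "supported m N b" "supported m N c"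
  shows "imat_mult (imat_mult a b) c = imat_mult a (imat_mult b c)"
proof (intro ext)
  fix i j
  let ?W = "window m N"
  have "(\<Sum>k\<in>?W. (\<Sum>l\<in>?W. a i l * b l k) * c k j) = (\<Sum>l\<in>?W. a i l * (\<Sum>k\<in>?W. b l k * c k j))"
    unfolding sum_distrib_left sum_distrib_right
    by (subst sum.swap) (simp add: mult.assoc)
  moreover have "(\<Sum>k\<in>?W. imat_mult a b i k * c k j) = (\<Sum>k\<in>?W. (\<Sum>l\<in>?W. a i l * b l k) * c k j)"
    if "i \<in> ?W"
    using that by (intro sum.cong) (auto simp: imat_mult_entry[OF assms(1,2)])
  moreover have "(\<Sum>l\<in>?W. a i l * imat_mult b c l j) = (\<Sum>l\<in>?W. a i l * (\<Sum>k\<in>?W. b l k * c k j))"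
    if "j \<in> ?W"
    using that by (intro sum.cong) (auto simp: imat_mult_entry[OF assms(2,3)])
  ultimately show "imat_mult (imat_mult a b) c i j = imat_mult a (imat_mult b c) i j"
    by (simp add: imat_mult_entry[OF supported_mult[OF assms(1,2)] assms(3)]
        imat_mult_entry[OF assms(1) supported_mult[OF assms(2,3)]])
qed

text \<open>A row of \<open>a\<close> outside the window is a unit row, so that row of
  \<open>imat_mult a h\<close> is the row of \<open>h\<close> itself; columns are treated with the
  other product. Thus \<open>h\<close> is not assumed to be finitary.\<close>

lemma imat_inverse_supported:
  assumes a: "supported m N a" and h: "is_imat m h"
    and "imat_mult a h = imat_one m" "imat_mult h a = imat_one m"
  shows "supported m N h"
proof (rule supportedI)
  fix i j
  assume "i \<notin> window m N \<or> j \<notin> window m N"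
  then show "h i j = imat_one m i j"
  proof
    assume "i \<notin> window m N"
    then have "imat_mult a h i j = h i j"
      by (intro imat_mult_one_row[where m = m] supported_entry[OF a] h) auto
    then show ?thesis using assms by simp
  next
    assume "j \<notin> window m N"
    then have "imat_mult h a i j = h i j"
      by (intro imat_mult_one_col[where m = m] supported_entry[OF a] h) auto
    then show ?thesis using assms by simp
  qed
qed

section \<open>The group of finitary invertible matrices\<close>

text \<open>Places an element and its inverse in the same window, which turns the group axioms into
  computations with supported matrices.\<close>

lemma carrier_GL_iff:
  "g \<in> carrier (GL m) \<longleftrightarrow>
    (\<exists>N. supported m N g \<and> (\<exists>h. supported m N h \<and> imat_mult g h = imat_one m \<and> imat_mult h g = imat_one m))"
  (is "?l \<longleftrightarrow> ?r")
proof
  assume ?l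
  then obtain h where g: "is_imat m g" "finitary m g"
    and h: "is_imat m h" "imat_mult g h = imat_one m" "imat_mult h g = imat_one m"
    by (auto simp: GL_def imat_invertible_def)
  then show ?r
    using finitary_supported[OF g] imat_inverse_supported[OF _ h] by blast
next
  assume ?r
  then show ?l
    using supported_is_imat supported_finitary by (auto simp: GL_def imat_invertible_def)
qed

lemma carrier_supported: "g \<in> carrier (GL m) \<Longrightarrow> \<exists>N. supported m N g"
  by (auto simp: carrier_GL_iff)

lemma GL_mult: "x \<otimes>\<^bsub>GL m\<^esub> y = imat_mult x y"
  by (simp add: GL_def)

lemma GL_one: "\<one>\<^bsub>GL m\<^esub> = imat_one m"
  by (simp add: GL_def)

lemma group_GL: "group (GL m :: 'k::field imat monoid)"
proof (rule groupI)
  fix x y z :: "'k imat"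
  assume "x \<in> carrier (GL m)" "y \<in> carrier (GL m)"
  then obtain N1 N2 x' y' where
    x: "supported m N1 x" "supported m N1 x'" "imat_mult x x' = imat_one m" "imat_mult x' x = imat_one m"
    and y: "supported m N2 y" "supported m N2 y'" "imat_mult y y' = imat_one m" "imat_mult y' y = imat_one m"
    by (auto simp: carrier_GL_iff)
  define N where "N = max N1 N2"
  have s: "supported m N x" "supported m N x'" "supported m N y" "supported m N y'"
    using x y by (simp_all add: N_def supported_mono[OF _ max.cobounded1] supported_mono[OF _ max.cobounded2])
  note assoc = imat_mult_assoc[where m = m and N = N]
  have "imat_mult (imat_mult x y) (imat_mult y' x') = imat_mult x (imat_mult (imat_mult y y') x')"
    by (simp add: assoc s supported_mult)
  moreover have "imat_mult (imat_mult y' x') (imat_mult x y) = imat_mult y' (imat_mult (imat_mult x' x) y)"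
    by (simp add: assoc s supported_mult)
  ultimately have "imat_mult (imat_mult x y) (imat_mult y' x') = imat_one m"
    "imat_mult (imat_mult y' x') (imat_mult x y) = imat_one m"
    using x y s by (simp_all add: imat_mult_one_left supported_is_imat[OF s(2)] supported_is_imat[OF s(3)])
  then show "x \<otimes>\<^bsub>GL m\<^esub> y \<in> carrier (GL m)"
    unfolding carrier_GL_iff GL_mult
    using supported_mult[OF s(1,3)] supported_mult[OF s(4,2)] by blast
next
  show "\<one>\<^bsub>GL m\<^esub> \<in> carrier (GL m :: 'k imat monoid)"
    unfolding carrier_GL_iff GL_one
    by (intro exI[of _ 0] conjI exI[of _ "imat_one m"] supported_one imat_mult_one_left
        supported_is_imat[OF supported_one])
next
  fix x y z :: "'k imat"
  assume "x \<in> carrier (GL m)" "y \<in> carrier (GL m)" "z \<in> carrier (GL m)"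
  from this[THEN carrier_supported] obtain N1 N2 N3
    where N: "supported m N1 x" "supported m N2 y" "supported m N3 z"
    by (elim exE)
  have "supported m (N1 + N2 + N3) x" "supported m (N1 + N2 + N3) y" "supported m (N1 + N2 + N3) z"
    by (rule supported_mono[OF N(1)], simp, rule supported_mono[OF N(2)], simp,
        rule supported_mono[OF N(3)], simp)
  then show "x \<otimes>\<^bsub>GL m\<^esub> y \<otimes>\<^bsub>GL m\<^esub> z = x \<otimes>\<^bsub>GL m\<^esub> (y \<otimes>\<^bsub>GL m\<^esub> z)"
    unfolding GL_mult by (rule imat_mult_assoc)
next
  fix x :: "'k imat"
  assume x: "x \<in> carrier (GL m)"
  then show "\<one>\<^bsub>GL m\<^esub> \<otimes>\<^bsub>GL m\<^esub> x = x"
    by (simp add: GL_def imat_mult_one_left)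
  from x obtain N h where "supported m N x" "supported m N h"
    "imat_mult x h = imat_one m" "imat_mult h x = imat_one m"
    by (auto simp: carrier_GL_iff)
  then show "\<exists>y\<in>carrier (GL m). y \<otimes>\<^bsub>GL m\<^esub> x = \<one>\<^bsub>GL m\<^esub>"
    unfolding GL_mult GL_one by (intro bexI[of _ h]) (auto simp: carrier_GL_iff)
qed

interpretation GL: group "GL m :: 'k::field imat monoid" for m
  by (rule group_GL)

text \<open>Keeping the same \<open>N\<close> allows the product of the inverse cosets to be
  evaluated with the shift chosen for \<open>a\<close> and \<open>p\<close>. The auxiliary
  \<open>M\<close> only serves to show that the inverse is an \<open>is_imat\<close>.\<close>

lemma supported_inv:
  assumes "g \<in> carrier (GL m)" "supported m N g"
  shows "supported m N (inv\<^bsub>GL m\<^esub> g)"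
proof -
  from GL.inv_closed[OF assms(1)] obtain M where "supported m M (inv\<^bsub>GL m\<^esub> g)"
    using carrier_supported by blast
  then show ?thesis
    using imat_inverse_supported[OF assms(2) supported_is_imat]
      GL.r_inv[OF assms(1), unfolded GL_mult GL_one] GL.l_inv[OF assms(1), unfolded GL_mult GL_one]
    by blast
qed

subsection \<open>The subgroup \<open>P\<close>\<close>

text \<open>The blocks left free in P are exactly those with a row in L or a column in R, so the
  four block conditions merge into one. Indices outside \<open>index_set m\<close> may be included,
  because both sides vanish there.\<close>

lemma P_iff:
  fixes g :: "'k::field imat"
  shows "g \<in> P m \<longleftrightarrow> g \<in> carrier (GL m) \<and>
    (\<forall>i j. i \<notin> range IL \<longrightarrow> j \<notin> range IR \<longrightarrow> g i j = imat_one m i j)" (is "?l \<longleftrightarrow> ?r")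
proof
  assume g: ?l
  then have im: "is_imat m g" by (simp add: P_def GL_def)
  have "g i j = imat_one m i j" if "i \<notin> range IL" "j \<notin> range IR" for i j
  proof (cases "i \<in> index_set m \<and> j \<in> index_set m")
    case True
    then show ?thesis
      using g that by (cases i; cases j) (auto simp: P_def imat_one_def index_set_def)
  next
    case False
    then have "g i j = 0" using im by (auto simp: is_imat_def)
    then show ?thesis using False by (auto simp: imat_one_def)
  qed
  then show ?r using g by (auto simp: P_def)
next
  assume g: ?r
  then have eq: "g i j = imat_one m i j" if "i \<notin> range IL" "j \<notin> range IR" for i j
    using that by blast
  have "g (IC i) (IL j) = 0" "g (IR i) (IL j) = 0" "g (IR i) (IC j) = 0"
    "g (IC i) (IC j) = (if i = j \<and> i \<in> {1..m} then 1 else 0)" for i j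
    by (subst eq; auto simp: imat_one_def index_set_def)+
  then show ?l
    using g unfolding P_def by simp
qed

lemma P_entry: "g \<in> P m \<Longrightarrow> i \<notin> range IL \<Longrightarrow> j \<notin> range IR \<Longrightarrow> g i j = imat_one m i j"
  by (simp add: P_iff)

lemma P_carrier: "g \<in> P m \<Longrightarrow> g \<in> carrier (GL m)"
  by (simp add: P_def)

lemma P_mult:
  fixes g h :: "'k::field imat"
  assumes g: "g \<in> P m" and h: "h \<in> P m"
  shows "g \<otimes>\<^bsub>GL m\<^esub> h \<in> P m"
proof -
  have "imat_mult g h i j = imat_one m i j" if "i \<notin> range IL" "j \<notin> range IR" for i j
  proof -
    have "g i k * h k j = (if k = i then imat_one m i j else 0)" for k
      using P_entry[OF g that(1), of k] P_entry[OF h _ that(2), of k] that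
      by (cases "k \<in> range IR"; cases "k \<in> range IL") (auto simp: imat_one_def)
    then have "imat_mult g h i j = Sum_any (\<lambda>k. if k = i then imat_one m i j else 0)"
      by (simp add: imat_mult_def)
    also have "\<dots> = imat_one m i j" by simp
    finally show ?thesis .
  qed
  then show ?thesis
    using g h GL.m_closed[of g m h] by (simp add: P_iff GL_mult)
qed

text \<open>
  The \<open>R\<close>-block \<open>\<beta>\<close> of \<open>g\<close> and that of the inverse \<open>h\<close> satisfy \<open>\<beta> h\<^sub>R\<^sub>R = 1\<close>, hence \<open>h\<^sub>R\<^sub>R \<beta> = 1\<close>
  as \<open>\<beta>\<close> is essentially of finite size. Since \<open>\<beta>\<close> annihilates the remaining part of the
  rows of \<open>h\<close> in \<open>R\<close>, that part vanishes.
\<close>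

lemma P_inv:
  fixes g :: "'k::field imat"
  assumes g: "g \<in> P m"
  shows "inv\<^bsub>GL m\<^esub> g \<in> P m"
proof -
  define h where "h = inv\<^bsub>GL m\<^esub> g"
  have gc: "g \<in> carrier (GL m)" and hc: "h \<in> carrier (GL m)"
    using g by (simp_all add: P_carrier h_def)
  obtain N where sg: "supported m N g" using carrier_supported gc by blast
  then have sh: "supported m N h" using supported_inv gc h_def by blast
  let ?W = "window m N"
  define S where "S = ?W \<inter> range IR"
  have "finite S" by (simp add: S_def)
  have gh: "imat_mult g h = imat_one m"
    using GL.r_inv[OF gc] by (simp add: h_def GL_mult GL_one)
  have row: "(\<Sum>k\<in>S. g i k * h k j) = imat_one m i j" if "i \<in> S" "j \<in> ?W" for i j
  proof -
    have "g i k * h k j = 0" if "k \<in> ?W - S" for k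
      using that \<open>i \<in> S\<close> P_entry[OF g, of i k] by (fastforce simp: S_def imat_one_def)
    then have "(\<Sum>k\<in>S. g i k * h k j) = (\<Sum>k\<in>?W. g i k * h k j)"
      by (intro sum.mono_neutral_left) (auto simp: S_def)
    also have "\<dots> = imat_mult g h i j"
      using that by (simp add: imat_mult_entry[OF sg sh] S_def)
    finally show ?thesis using gh by simp
  qed
  have hg: "(\<Sum>k\<in>S. h i k * g k j) = (if i = j then 1 else 0)" if "i \<in> S" "j \<in> S" for i j
  proof (rule finite_left_inverse_imp_right_inverse[OF \<open>finite S\<close> _ that])
    fix i j
    assume "i \<in> S" "j \<in> S"
    then show "(\<Sum>k\<in>S. g i k * h k j) = (if i = j then 1 else 0)"
      using row[of i j] window_subset[of m N] by (auto simp: S_def imat_one_def)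
  qed
  have van: "h i j = 0" if "i \<in> S" "j \<in> ?W" "j \<notin> range IR" for i j
  proof -
    have "0 = (\<Sum>k\<in>S. h i k * (\<Sum>l\<in>S. g k l * h l j))"
      using that by (intro sum.neutral[symmetric]) (auto simp: row imat_one_def, auto simp: S_def)
    also have "\<dots> = (\<Sum>l\<in>S. (\<Sum>k\<in>S. h i k * g k l) * h l j)"
      unfolding sum_distrib_left sum_distrib_right
      by (subst sum.swap) (simp add: mult.assoc)
    also have "\<dots> = (\<Sum>l\<in>S. if i = l then h l j else 0)"
      using that by (intro sum.cong) (auto simp: hg)
    also have "\<dots> = h i j" using that \<open>finite S\<close> by simp
    finally show ?thesis by simp
  qed
  have "h i j = imat_one m i j" if ij: "i \<notin> range IL" "j \<notin> range IR" for i j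
  proof (cases "i \<in> ?W \<and> j \<in> ?W")
    case True
    \<comment> \<open>For \<open>k\<close> outside R the entry of \<open>g\<close> is a unit entry;
      for \<open>k\<close> in R the factor \<open>h k j\<close> vanishes by \<open>van\<close>. This
      settles the rows in C together with those in R.\<close>
    have "g i k * h k j = (if i = k then h i j else 0)" if "k \<in> ?W" for k
    proof (cases "k \<in> range IR")
      case True
      then have "h k j = 0" using van that ij \<open>i \<in> ?W \<and> j \<in> ?W\<close> by (simp add: S_def)
      then show ?thesis by auto
    next
      case False
      then show ?thesis
        using P_entry[OF g ij(1) False] that window_subset[of m N] by (auto simp: imat_one_def)
    qed
    then have "(\<Sum>k\<in>?W. g i k * h k j) = (\<Sum>k\<in>?W. if i = k then h i j else 0)"
      by (intro sum.cong) auto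
    then show ?thesis
      using fun_cong[OF fun_cong[OF gh, of i], of j] True by (simp add: imat_mult_entry[OF sg sh])
  qed (use supported_entry[OF sh] in blast)
  then show ?thesis using hc by (simp add: P_iff h_def)
qed

lemma subgroup_P: "subgroup (P m) (GL m :: 'k::field imat monoid)"
proof -
  have "\<one>\<^bsub>GL m\<^esub> \<in> (P m :: 'k imat set)"
    using GL.one_closed by (simp add: P_iff GL_one)
  then show ?thesis
    by unfold_locales (auto simp: P_mult P_inv P_carrier)
qed


section \<open>Double cosets and their involution\<close>

lemma mem_dcoset_iff: "h \<in> dcoset m g \<longleftrightarrow> (\<exists>x\<in>P m. \<exists>y\<in>P m. h = x \<otimes>\<^bsub>GL m\<^esub> g \<otimes>\<^bsub>GL m\<^esub> y)"
  by (auto simp: dcoset_def r_coset_def set_mult_def)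

lemma dcoset_subset:
  fixes g :: "'k::field imat"
  assumes "g \<in> carrier (GL m)" "x \<in> P m" "y \<in> P m"
  shows "dcoset m (x \<otimes>\<^bsub>GL m\<^esub> g \<otimes>\<^bsub>GL m\<^esub> y) \<subseteq> dcoset m g"
proof
  fix h
  assume "h \<in> dcoset m (x \<otimes>\<^bsub>GL m\<^esub> g \<otimes>\<^bsub>GL m\<^esub> y)"
  then obtain u v where uv: "u \<in> P m" "v \<in> P m"
    "h = u \<otimes>\<^bsub>GL m\<^esub> (x \<otimes>\<^bsub>GL m\<^esub> g \<otimes>\<^bsub>GL m\<^esub> y) \<otimes>\<^bsub>GL m\<^esub> v"
    by (auto simp: mem_dcoset_iff)
  then have "h = (u \<otimes>\<^bsub>GL m\<^esub> x) \<otimes>\<^bsub>GL m\<^esub> g \<otimes>\<^bsub>GL m\<^esub> (y \<otimes>\<^bsub>GL m\<^esub> v)"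
    using assms by (simp add: GL.m_assoc P_carrier)
  then show "h \<in> dcoset m g"
    using P_mult[OF uv(1) assms(2)] P_mult[OF assms(3) uv(2)] unfolding mem_dcoset_iff by blast
qed

text \<open>The second inclusion is the first one for the inverse factors. Equalities of double
  cosets below come from moving factors in P to the two ends of a product.\<close>

lemma dcoset_eq:
  fixes g :: "'k::field imat"
  assumes "g \<in> carrier (GL m)" "x \<in> P m" "y \<in> P m"
  shows "dcoset m (x \<otimes>\<^bsub>GL m\<^esub> g \<otimes>\<^bsub>GL m\<^esub> y) = dcoset m g"
proof
  let ?h = "x \<otimes>\<^bsub>GL m\<^esub> g \<otimes>\<^bsub>GL m\<^esub> y"
  have "?h \<in> carrier (GL m)" using assms by (simp add: P_carrier)
  moreover have "g = inv\<^bsub>GL m\<^esub> x \<otimes>\<^bsub>GL m\<^esub> ?h \<otimes>\<^bsub>GL m\<^esub> inv\<^bsub>GL m\<^esub> y"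
  proof -
    have "inv\<^bsub>GL m\<^esub> x \<otimes>\<^bsub>GL m\<^esub> (x \<otimes>\<^bsub>GL m\<^esub> g) = g"
      using assms by (simp add: P_carrier GL.m_assoc[symmetric])
    then show ?thesis using assms by (simp add: P_carrier GL.m_assoc)
  qed
  ultimately show "dcoset m g \<subseteq> dcoset m ?h"
    using dcoset_subset[of ?h m "inv\<^bsub>GL m\<^esub> x" "inv\<^bsub>GL m\<^esub> y"]
      P_inv[OF assms(2)] P_inv[OF assms(3)] by metis
qed (rule dcoset_subset[OF assms])

lemma mem_dcoset_self:
  fixes g :: "'k::field imat"
  assumes "g \<in> carrier (GL m)"
  shows "g \<in> dcoset m g"
proof -
  have "\<one>\<^bsub>GL m\<^esub> \<in> (P m :: 'k imat set)" by (rule subgroup.one_closed[OF subgroup_P])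
  moreover have "g = \<one>\<^bsub>GL m\<^esub> \<otimes>\<^bsub>GL m\<^esub> g \<otimes>\<^bsub>GL m\<^esub> \<one>\<^bsub>GL m\<^esub>" using assms by simp
  ultimately show ?thesis unfolding mem_dcoset_iff by blast
qed

text \<open>Inversion reverses x a y to y^-1 a^-1 x^-1, whose outer factors are again in P. So all
  representatives give the same coset and the description by \<open>THE\<close> is
  determined.\<close>

lemma involution_dcoset:
  fixes a :: "'k::field imat"
  assumes a: "a \<in> carrier (GL m)"
  shows "involution m (dcoset m a) = dcoset m (inv\<^bsub>GL m\<^esub> a)"
  unfolding involution_def
proof (rule the_equality)
  show "\<exists>b\<in>dcoset m a. dcoset m (inv\<^bsub>GL m\<^esub> a) = dcoset m (inv\<^bsub>GL m\<^esub> b)"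
    using mem_dcoset_self[OF a] by blast
next
  fix D
  assume "\<exists>b\<in>dcoset m a. D = dcoset m (inv\<^bsub>GL m\<^esub> b)"
  then obtain x y where xy: "x \<in> P m" "y \<in> P m"
    and D: "D = dcoset m (inv\<^bsub>GL m\<^esub> (x \<otimes>\<^bsub>GL m\<^esub> a \<otimes>\<^bsub>GL m\<^esub> y))"
    by (auto simp: mem_dcoset_iff)
  have "inv\<^bsub>GL m\<^esub> (x \<otimes>\<^bsub>GL m\<^esub> a \<otimes>\<^bsub>GL m\<^esub> y) = inv\<^bsub>GL m\<^esub> y \<otimes>\<^bsub>GL m\<^esub> inv\<^bsub>GL m\<^esub> a \<otimes>\<^bsub>GL m\<^esub> inv\<^bsub>GL m\<^esub> x"
    using xy a by (simp add: P_carrier GL.inv_mult_group GL.m_assoc)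
  then show "D = dcoset m (inv\<^bsub>GL m\<^esub> a)"
    using D dcoset_eq[OF GL.inv_closed[OF a] P_inv[OF xy(2)] P_inv[OF xy(1)]] by simp
qed

subsection \<open>Permutation matrices\<close>

text \<open>Common features of two permutations: the one behind \<open>J\<close>, and the one that
  later changes \<open>N\<close>. Preserving L and R and fixing C makes the permutation matrix block
  diagonal with unit middle block, hence an element of P.\<close>

definition index_involution :: "nat \<Rightarrow> nat \<Rightarrow> (idx \<Rightarrow> idx) \<Rightarrow> bool" where
  "index_involution m K \<pi> \<longleftrightarrow> (\<forall>i. \<pi> (\<pi> i) = i) \<and> (\<forall>i. i \<notin> window m K \<longrightarrow> \<pi> i = i) \<and>
    (\<forall>i. \<pi> i \<in> range IL \<longleftrightarrow> i \<in> range IL) \<and> (\<forall>i. \<pi> i \<in> range IR \<longleftrightarrow> i \<in> range IR) \<and>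
    (\<forall>i. \<pi> (IC i) = IC i)"

definition perm_imat :: "nat \<Rightarrow> (idx \<Rightarrow> idx) \<Rightarrow> 'k::field imat" where
  "perm_imat m \<pi> = (\<lambda>i j. if i = \<pi> j \<and> j \<in> index_set m then 1 else 0)"

lemma J_eq_perm_imat: "J m N = perm_imat m (idx_swap N)"
  by (simp add: J_def perm_imat_def)

lemma index_involutionD:
  assumes "index_involution m K \<pi>"
  shows "\<pi> (\<pi> i) = i" "i \<notin> window m K \<Longrightarrow> \<pi> i = i" "\<pi> i \<in> range IL \<longleftrightarrow> i \<in> range IL"
    "\<pi> i \<in> range IR \<longleftrightarrow> i \<in> range IR" "\<pi> (IC c) = IC c"
  using assms by (auto simp: index_involution_def)

lemma index_involution_index_set:
  assumes "index_involution m K \<pi>"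
  shows "\<pi> i \<in> index_set m \<longleftrightarrow> i \<in> index_set m"
  using index_involutionD(1,2)[OF assms] window_subset[of m K] by (metis subsetD)

lemma index_involution_eq_iff:
  assumes "index_involution m K \<pi>"
  shows "i = \<pi> j \<longleftrightarrow> \<pi> i = j"
  using index_involutionD(1)[OF assms] by metis

lemma imat_one_perm:
  assumes "index_involution m K \<pi>"
  shows "imat_one m (\<pi> i) (\<pi> j) = imat_one m i j"
  using index_involution_eq_iff[OF assms, of "\<pi> i" j]
  by (auto simp: imat_one_def index_involution_index_set[OF assms] index_involutionD(1)[OF assms])

lemma supported_perm_imat:
  assumes "index_involution m K \<pi>"
  shows "supported m K (perm_imat m \<pi>)"
proof (rule supportedI)
  fix i j
  assume "i \<notin> window m K \<or> j \<notin> window m K"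
  then have "\<pi> i = i \<or> \<pi> j = j"
    using index_involutionD(2)[OF assms] by blast
  then have "i = \<pi> j \<longleftrightarrow> i = j"
    using index_involution_eq_iff[OF assms, of i j] by auto
  then show "perm_imat m \<pi> i j = imat_one m i j"
    by (auto simp: perm_imat_def imat_one_def)
qed

lemma imat_mult_perm_left:
  assumes \<pi>: "index_involution m K \<pi>" and a: "is_imat m a"
  shows "imat_mult (perm_imat m \<pi>) a i j = a (\<pi> i) j"
proof -
  have "Sum_any (\<lambda>k. perm_imat m \<pi> i k * a k j) = (\<Sum>k\<in>{\<pi> i}. perm_imat m \<pi> i k * a k j)"
    by (rule Sum_any.expand_superset)
      (auto simp: perm_imat_def index_involutionD(1)[OF \<pi>])
  then show ?thesis
    using a by (auto simp: imat_mult_def perm_imat_def is_imat_def index_involutionD(1)[OF \<pi>])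
qed

lemma imat_mult_perm_right:
  assumes \<pi>: "index_involution m K \<pi>" and a: "is_imat m a"
  shows "imat_mult a (perm_imat m \<pi>) i j = a i (\<pi> j)"
proof -
  have "Sum_any (\<lambda>k. a i k * perm_imat m \<pi> k j) = (\<Sum>k\<in>{\<pi> j}. a i k * perm_imat m \<pi> k j)"
    by (rule Sum_any.expand_superset) (auto simp: perm_imat_def split: if_splits)
  then show ?thesis
    using a index_involution_index_set[OF \<pi>, of j]
    by (auto simp: imat_mult_def perm_imat_def is_imat_def)
qed

lemma perm_imat_square:
  assumes \<pi>: "index_involution m K \<pi>"
  shows "imat_mult (perm_imat m \<pi>) (perm_imat m \<pi>) = imat_one m"
proof (intro ext)
  fix i j
  show "imat_mult (perm_imat m \<pi>) (perm_imat m \<pi>) i j = imat_one m i j"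
    using imat_mult_perm_left[OF \<pi> supported_is_imat[OF supported_perm_imat[OF \<pi>]], of i j]
      index_involution_eq_iff[OF \<pi>, of "\<pi> i" j]
    by (auto simp: perm_imat_def imat_one_def index_involutionD(1)[OF \<pi>])
qed

lemma perm_imat_in_P:
  assumes \<pi>: "index_involution m K \<pi>"
  shows "(perm_imat m \<pi> :: 'k::field imat) \<in> P m"
  unfolding P_iff
proof (intro conjI allI impI)
  show "(perm_imat m \<pi> :: 'k imat) \<in> carrier (GL m)"
    unfolding carrier_GL_iff using supported_perm_imat[OF \<pi>] perm_imat_square[OF \<pi>] by blast
next
  fix i j
  assume ij: "i \<notin> range IL" "j \<notin> range IR"
  show "(perm_imat m \<pi> :: 'k imat) i j = imat_one m i j"
  proof (cases "j \<in> range IL")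
    case True
    then have "i \<noteq> j" "i \<noteq> \<pi> j"
      using ij index_involutionD(3)[OF \<pi>, of j] by auto
    then show ?thesis by (simp add: perm_imat_def imat_one_def)
  next
    case False
    then obtain c where "j = IC c" using ij by (cases j) auto
    then show ?thesis
      using index_involutionD(5)[OF \<pi>] by (auto simp: perm_imat_def imat_one_def)
  qed
qed

lemma perm_conj_entry:
  fixes a :: "'k::field imat"
  assumes \<pi>: "index_involution m K \<pi>" and a: "supported m N a"
  shows "(perm_imat m \<pi> \<otimes>\<^bsub>GL m\<^esub> a \<otimes>\<^bsub>GL m\<^esub> perm_imat m \<pi>) i j = a (\<pi> i) (\<pi> j)"
proof -
  have s: "supported m (N + K) a" "supported m (N + K) (perm_imat m \<pi>)"
    by (rule supported_mono[OF a], simp, rule supported_mono[OF supported_perm_imat[OF \<pi>]], simp)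
  show ?thesis
    unfolding GL_mult
    by (simp add: imat_mult_perm_right[OF \<pi>] imat_mult_perm_left[OF \<pi>]
        supported_is_imat[OF supported_mult[OF s(2,1)]] supported_is_imat[OF a])
qed

section \<open>Conjugation by \<open>J\<close>\<close>

text \<open>Both permutations act on L and on R through the same map of the numbers, so their
  properties reduce to statements on \<open>nat\<close>.\<close>

fun idx_map :: "(nat \<Rightarrow> nat) \<Rightarrow> idx \<Rightarrow> idx" where
  "idx_map s (IL i) = IL (s i)"
| "idx_map s (IC i) = IC i"
| "idx_map s (IR i) = IR (s i)"

lemma idx_swap_eq_idx_map: "idx_swap N = idx_map (shift_swap N)"
proof
  show "idx_swap N i = idx_map (shift_swap N) i" for i by (cases i) auto
qed

lemma index_involution_idx_map:
  assumes "\<And>i. s (s i) = i" "\<And>i. i \<notin> {1..K} \<Longrightarrow> s i = i"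
  shows "index_involution m K (idx_map s)"
  unfolding index_involution_def
proof (intro conjI allI impI)
  fix i
  show "idx_map s (idx_map s i) = i" by (cases i) (simp_all add: assms)
  show "idx_map s i = i" if "i \<notin> window m K"
    using that by (cases i) (auto simp: window_def intro!: assms(2))
  show "idx_map s i \<in> range IL \<longleftrightarrow> i \<in> range IL" by (cases i) auto
  show "idx_map s i \<in> range IR \<longleftrightarrow> i \<in> range IR" by (cases i) auto
qed simp

lemma shift_swap_shift_swap: "shift_swap N (shift_swap N i) = i"
  by (auto simp: shift_swap_def)

text \<open>The factor 2 arises because the numbers 1 to \<open>N\<close> are exchanged with
  \<open>N + 1\<close> to \<open>2 * N\<close>.\<close>

lemma index_involution_idx_swap: "index_involution m (2 * N) (idx_swap N)"
  unfolding idx_swap_eq_idx_map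
  by (rule index_involution_idx_map[OF shift_swap_shift_swap]) (auto simp: shift_swap_def)

lemma J_in_P: "J m N \<in> P m"
  unfolding J_eq_perm_imat by (rule perm_imat_in_P[OF index_involution_idx_swap])

lemma J_square: "(J m N :: 'k::field imat) \<otimes>\<^bsub>GL m\<^esub> J m N = \<one>\<^bsub>GL m\<^esub>"
  unfolding J_eq_perm_imat GL_mult GL_one by (rule perm_imat_square[OF index_involution_idx_swap])

text \<open>An involutive automorphism of the group that preserves P; the star product is
  represented by \<open>a\<close> times the shifted \<open>p\<close>.\<close>

definition shift :: "nat \<Rightarrow> nat \<Rightarrow> 'k::field imat \<Rightarrow> 'k imat" where
  "shift m N g = J m N \<otimes>\<^bsub>GL m\<^esub> g \<otimes>\<^bsub>GL m\<^esub> J m N"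

lemma J_carrier: "J m N \<in> carrier (GL m)"
  by (rule P_carrier[OF J_in_P])

lemma J_J_mult:
  "(g :: 'k::field imat) \<in> carrier (GL m) \<Longrightarrow> J m N \<otimes>\<^bsub>GL m\<^esub> (J m N \<otimes>\<^bsub>GL m\<^esub> g) = g"
  by (simp add: GL.m_assoc[symmetric] J_carrier J_square)

lemma shift_carrier: "g \<in> carrier (GL m) \<Longrightarrow> shift m N g \<in> carrier (GL m)"
  by (simp add: shift_def J_carrier)

lemma shift_in_P: "g \<in> P m \<Longrightarrow> shift m N g \<in> P m"
  by (simp add: shift_def J_in_P P_mult)

lemma shift_shift:
  "(g :: 'k::field imat) \<in> carrier (GL m) \<Longrightarrow> shift m N (shift m N g) = g"
  by (simp add: shift_def GL.m_assoc J_carrier J_square J_J_mult)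

lemma shift_mult:
  "(g :: 'k::field imat) \<in> carrier (GL m) \<Longrightarrow> h \<in> carrier (GL m) \<Longrightarrow>
    shift m N (g \<otimes>\<^bsub>GL m\<^esub> h) = shift m N g \<otimes>\<^bsub>GL m\<^esub> shift m N h"
  by (simp add: shift_def GL.m_assoc J_carrier J_J_mult)

lemma inv_J: "inv\<^bsub>GL m\<^esub> (J m N) = (J m N :: 'k::field imat)"
  by (rule GL.inv_equality[OF J_square J_carrier J_carrier])

lemma shift_inv:
  "(g :: 'k::field imat) \<in> carrier (GL m) \<Longrightarrow> shift m N (inv\<^bsub>GL m\<^esub> g) = inv\<^bsub>GL m\<^esub> (shift m N g)"
  by (simp add: shift_def GL.m_assoc GL.inv_mult_group J_carrier inv_J)

lemma shift_entry: "supported m N g \<Longrightarrow> shift m M g i j = g (idx_swap M i) (idx_swap M j)"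
  unfolding shift_def J_eq_perm_imat by (rule perm_conj_entry[OF index_involution_idx_swap])

lemma supported_shift:
  assumes "supported m N g"
  shows "supported m (2 * N) (shift m N g)"
proof -
  have "supported m (2 * N) g" by (rule supported_mono[OF assms]) simp
  then show ?thesis
    unfolding shift_def GL_mult J_eq_perm_imat
    by (intro supported_mult supported_perm_imat index_involution_idx_swap)
qed

lemma idx_swap_notin_window:
  "i \<in> window m N \<Longrightarrow> i \<notin> range IC \<Longrightarrow> idx_swap N i \<notin> window m N"
  by (auto simp: window_def shift_swap_def)

text \<open>The swap carries the L- and R-indices of the window out of it, to where \<open>g\<close>
  agrees with the unit matrix.\<close>

lemma shift_outside:
  assumes g: "supported m N g" and i: "i \<in> window m N" "i \<notin> range IC"
  shows "shift m N g i j = imat_one m i j" "shift m N g j i = imat_one m j i"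
  using supported_entry[OF g, of "idx_swap N i" "idx_swap N j"]
    supported_entry[OF g, of "idx_swap N j" "idx_swap N i"] idx_swap_notin_window[OF i]
  by (simp_all add: shift_entry[OF g] imat_one_perm[OF index_involution_idx_swap])

subsection \<open>The product of double cosets\<close>

text \<open>
  A nonzero entry \<open>(k, l)\<close> of \<open>y - 1\<close> has \<open>k\<close> in \<open>L\<close> or \<open>l\<close> in \<open>R\<close>. The shifted \<open>g\<close> acts
  trivially on these indices, as they lie in the unshifted window, so conjugation keeps the
  row \<open>k\<close> in \<open>L\<close>, respectively the column \<open>l\<close> in \<open>R\<close>.
\<close>

lemma conj_shift_in_P:
  fixes g y :: "'k::field imat"
  assumes gc: "g \<in> carrier (GL m)" and yP: "y \<in> P m"
    and g: "supported m N g" and y: "supported m N y"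
  shows "shift m N g \<otimes>\<^bsub>GL m\<^esub> y \<otimes>\<^bsub>GL m\<^esub> inv\<^bsub>GL m\<^esub> (shift m N g) \<in> P m"
proof -
  define G where "G = shift m N g"
  define H where "H = inv\<^bsub>GL m\<^esub> G"
  let ?W = "window m (2 * N)"
  have Gc: "G \<in> carrier (GL m)" by (simp add: G_def shift_carrier gc)
  have ig: "supported m N (inv\<^bsub>GL m\<^esub> g)" by (rule supported_inv[OF gc g])
  have H_shift: "H = shift m N (inv\<^bsub>GL m\<^esub> g)"
    by (simp add: H_def G_def shift_inv gc)
  have sG: "supported m (2 * N) G" by (simp add: G_def supported_shift g)
  have sH: "supported m (2 * N) H" by (simp add: H_shift supported_shift ig)
  have sy: "supported m (2 * N) y" by (rule supported_mono[OF y]) simp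
  \<comment> \<open>Stated for a general \<open>z\<close>, because it is needed both for
    \<open>y\<close> and for the unit matrix.\<close>
  have entry: "imat_mult (imat_mult G z) H i j = (\<Sum>l\<in>?W. (\<Sum>k\<in>?W. G i k * z k l) * H l j)"
    if "i \<in> ?W" "j \<in> ?W" and z: "supported m (2 * N) z" for i j z
  proof -
    have "imat_mult (imat_mult G z) H i j = (\<Sum>l\<in>?W. imat_mult G z i l * H l j)"
      using that by (simp add: imat_mult_entry[OF supported_mult[OF sG z] sH])
    also have "\<dots> = (\<Sum>l\<in>?W. (\<Sum>k\<in>?W. G i k * z k l) * H l j)"
      using that by (intro sum.cong) (auto simp: imat_mult_entry[OF sG z])
    finally show ?thesis .
  qed
  have "imat_mult (imat_mult G y) H i j = imat_one m i j" if ij: "i \<notin> range IL" "j \<notin> range IR" for i j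
  proof (cases "i \<in> ?W \<and> j \<in> ?W")
    case True
    \<comment> \<open>Each summand of G (y - 1) H vanishes at these positions. So \<open>y\<close>
      may be replaced by the unit matrix, and G H = 1 concludes.\<close>
    have eq: "G i k * y k l * H l j = G i k * imat_one m k l * H l j" for k l
    proof (cases "y k l = imat_one m k l")
      case False
      then have kl: "k \<in> window m N" "l \<in> window m N" using supported_entry[OF y] by blast+
      from False have "k \<in> range IL \<or> l \<in> range IR" using P_entry[OF yP] by blast
      then have "G i k = 0 \<or> H l j = 0"
      proof
        assume k: "k \<in> range IL"
        then have "G i k = imat_one m i k"
          unfolding G_def by (intro shift_outside(2)[OF g kl(1)]) auto
        then show ?thesis using k ij(1) by (auto simp: imat_one_def)
      next
        assume l: "l \<in> range IR"
        then have "H l j = imat_one m l j"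
          unfolding H_shift by (intro shift_outside(1)[OF ig kl(2)]) auto
        then show ?thesis using l ij(2) by (auto simp: imat_one_def)
      qed
      then show ?thesis by auto
    qed simp
    have "imat_mult (imat_mult G y) H i j = imat_mult (imat_mult G (imat_one m)) H i j"
      using True by (simp add: entry sy supported_one sum_distrib_right eq)
    also have "\<dots> = imat_mult G H i j"
      by (simp add: imat_mult_one_right supported_is_imat[OF sG])
    also have "\<dots> = imat_one m i j"
      using GL.r_inv[OF Gc] by (simp add: H_def GL_mult GL_one)
    finally show ?thesis .
  next
    case False
    then show ?thesis
      using supported_entry[OF supported_mult[OF supported_mult[OF sG sy] sH]] by blast
  qed
  moreover have "G \<otimes>\<^bsub>GL m\<^esub> y \<otimes>\<^bsub>GL m\<^esub> H \<in> carrier (GL m)"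
    using Gc P_carrier[OF yP] by (simp add: H_def)
  ultimately show ?thesis
    unfolding P_iff G_def[symmetric] H_def[symmetric] by (simp add: GL_mult)
qed

text \<open>Applying the shift to the previous result exchanges the roles of shifted and unshifted
  factors.\<close>

lemma conj_unshifted_in_P:
  fixes g z :: "'k::field imat"
  assumes gc: "g \<in> carrier (GL m)" and zP: "z \<in> P m"
    and g: "supported m N g" and z: "supported m N z"
  shows "g \<otimes>\<^bsub>GL m\<^esub> shift m N z \<otimes>\<^bsub>GL m\<^esub> inv\<^bsub>GL m\<^esub> g \<in> P m"
proof -
  have zc: "z \<in> carrier (GL m)" by (rule P_carrier[OF zP])
  have "shift m N (shift m N g \<otimes>\<^bsub>GL m\<^esub> z \<otimes>\<^bsub>GL m\<^esub> inv\<^bsub>GL m\<^esub> (shift m N g)) \<in> P m"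
    by (rule shift_in_P[OF conj_shift_in_P[OF assms]])
  then show ?thesis
    by (simp add: shift_mult shift_inv shift_shift shift_carrier gc zc)
qed

section \<open>Independence of the size of the shift\<close>

text \<open>Exchanges the block \<open>N + 1\<close> to \<open>2 * N\<close>, where the shift by
  \<open>N\<close> places the window of \<open>p\<close>, with the block \<open>M + 1\<close> to
  \<open>M + N\<close>, where the shift by \<open>M\<close> places it. For
  \<open>2 * N \<le> M\<close> the blocks are disjoint from each other and from 1 to
  \<open>N\<close>, where \<open>a\<close> lives.\<close>

definition block_swap :: "nat \<Rightarrow> nat \<Rightarrow> nat \<Rightarrow> nat" where
  "block_swap N M i = (if N < i \<and> i \<le> 2 * N then i - N + M
    else if M < i \<and> i \<le> M + N then i - M + N else i)"

context
  fixes N M :: nat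
  assumes M: "2 * N \<le> M"
begin

lemma block_swap_block_swap: "block_swap N M (block_swap N M i) = i"
proof -
  consider "N < i" "i \<le> 2 * N" | "M < i" "i \<le> M + N"
    | "i \<le> N" | "2 * N < i" "i \<le> M" | "M + N < i" by linarith
  then show ?thesis
    using M by cases (auto simp: block_swap_def)
qed

lemma block_swap_id: "i \<notin> {1..M + N} \<Longrightarrow> block_swap N M i = i"
  using M unfolding block_swap_def by auto

lemma block_swap_small: "i \<in> {1..N} \<Longrightarrow> block_swap N M i = i"
  using M unfolding block_swap_def by auto

lemma block_swap_small_iff: "block_swap N M i \<in> {1..N} \<longleftrightarrow> i \<in> {1..N}"
  using block_swap_small block_swap_block_swap by metis

text \<open>The two maps differ in general, for instance at \<open>i = 2\<close> when
  \<open>N = 1\<close> and \<open>M = 2\<close>. They have to agree only where one of the values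
  lies in the window of \<open>p\<close>.\<close>

lemma shift_swap_block_swap:
  assumes "shift_swap M i \<in> {1..N} \<or> shift_swap N (block_swap N M i) \<in> {1..N}"
  shows "shift_swap N (block_swap N M i) = shift_swap M i"
proof -
  consider "1 \<le> i" "i \<le> N" | "N < i" "i \<le> 2 * N" | "M < i" "i \<le> M + N" | "i = 0"
    | "2 * N < i" "i \<le> M" | "M + N < i" by linarith
  then show ?thesis
    using M assms by cases (auto simp: block_swap_def shift_swap_def split: if_splits)
qed

end

lemma dcoset_shift_large:
  fixes a p :: "'k::field imat"
  assumes ac: "a \<in> carrier (GL m)" and pc: "p \<in> carrier (GL m)"
    and a: "supported m N a" and p: "supported m N p" and M: "2 * N \<le> M"
  shows "dcoset m (a \<otimes>\<^bsub>GL m\<^esub> shift m M p) = dcoset m (a \<otimes>\<^bsub>GL m\<^esub> shift m N p)"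
proof -
  define \<sigma> where "\<sigma> = idx_map (block_swap N M)"
  define S :: "'k imat" where "S = perm_imat m \<sigma>"
  have \<sigma>: "index_involution m (M + N) \<sigma>"
    unfolding \<sigma>_def
    by (rule index_involution_idx_map[OF block_swap_block_swap[OF M] block_swap_id[OF M]])
  have SP: "S \<in> P m" unfolding S_def by (rule perm_imat_in_P[OF \<sigma>])
  then have Sc: "S \<in> carrier (GL m)" by (rule P_carrier)
  have SS: "S \<otimes>\<^bsub>GL m\<^esub> S = \<one>\<^bsub>GL m\<^esub>"
    unfolding S_def GL_mult GL_one by (rule perm_imat_square[OF \<sigma>])
  have SSg: "S \<otimes>\<^bsub>GL m\<^esub> (S \<otimes>\<^bsub>GL m\<^esub> g) = g" if "g \<in> carrier (GL m)" for g
    using that by (simp add: GL.m_assoc[symmetric] Sc SS)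
  have conj_a: "S \<otimes>\<^bsub>GL m\<^esub> a \<otimes>\<^bsub>GL m\<^esub> S = a"
  proof (intro ext)
    fix i j
    \<comment> \<open>The second alternative excludes that an index enters the window of
      \<open>a\<close> from outside. So if \<open>\<sigma>\<close> moves \<open>i\<close> or
      \<open>j\<close>, both entries compared below are unit entries.\<close>
    have \<sigma>_window: "\<sigma> k = k" if "k \<in> window m N \<or> \<sigma> k \<in> window m N" for k
    proof (cases k)
      case (IL n)
      then show ?thesis
        using that block_swap_small[OF M, of n] block_swap_small_iff[OF M, of n]
        by (auto simp: \<sigma>_def IL_in_window)
    next
      case (IC n)
      then show ?thesis by (simp add: \<sigma>_def)
    next
      case (IR n)
      then show ?thesis
        using that block_swap_small[OF M, of n] block_swap_small_iff[OF M, of n]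
        by (auto simp: \<sigma>_def IR_in_window)
    qed
    have "a (\<sigma> i) (\<sigma> j) = a i j"
    proof (cases "\<sigma> i = i \<and> \<sigma> j = j")
      case False
      then have "a (\<sigma> i) (\<sigma> j) = imat_one m (\<sigma> i) (\<sigma> j)" "a i j = imat_one m i j"
        using \<sigma>_window[of i] \<sigma>_window[of j] supported_entry[OF a] by blast+
      then show ?thesis by (simp add: imat_one_perm[OF \<sigma>])
    qed simp
    then show "(S \<otimes>\<^bsub>GL m\<^esub> a \<otimes>\<^bsub>GL m\<^esub> S) i j = a i j"
      by (simp add: S_def perm_conj_entry[OF \<sigma> a])
  qed
  have conj_p: "S \<otimes>\<^bsub>GL m\<^esub> shift m N p \<otimes>\<^bsub>GL m\<^esub> S = shift m M p"
  proof (intro ext)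
    fix i j
    have win: "idx_swap N (\<sigma> k) = idx_swap M k"
      if "idx_swap M k \<in> window m N \<or> idx_swap N (\<sigma> k) \<in> window m N" for k
    proof (cases k)
      case (IL n)
      then show ?thesis
        using that shift_swap_block_swap[OF M, of n] by (simp add: \<sigma>_def IL_in_window)
    next
      case (IC n)
      then show ?thesis by (simp add: \<sigma>_def)
    next
      case (IR n)
      then show ?thesis
        using that shift_swap_block_swap[OF M, of n] by (simp add: \<sigma>_def IR_in_window)
    qed
    let ?i = "idx_swap N (\<sigma> i)" and ?j = "idx_swap N (\<sigma> j)"
    have "p ?i ?j = p (idx_swap M i) (idx_swap M j)"
    proof (cases "?i = idx_swap M i \<and> ?j = idx_swap M j")
      \<comment> \<open>Where the two maps differ, both images lie outside the window by
        \<open>win\<close>. Both entries of \<open>p\<close> are then unit entries, which permuting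
        the indices does not change.\<close>
      case False
      then have "p ?i ?j = imat_one m ?i ?j"
        "p (idx_swap M i) (idx_swap M j) = imat_one m (idx_swap M i) (idx_swap M j)"
        using win[of i] win[of j] supported_entry[OF p] by blast+
      then show ?thesis
        by (simp add: imat_one_perm[OF \<sigma>] imat_one_perm[OF index_involution_idx_swap])
    qed simp
    then show "(S \<otimes>\<^bsub>GL m\<^esub> shift m N p \<otimes>\<^bsub>GL m\<^esub> S) i j = shift m M p i j"
      unfolding S_def by (simp add: perm_conj_entry[OF \<sigma> supported_shift[OF p]] shift_entry[OF p])
  qed
  have "a \<otimes>\<^bsub>GL m\<^esub> shift m M p
      = (S \<otimes>\<^bsub>GL m\<^esub> a \<otimes>\<^bsub>GL m\<^esub> S) \<otimes>\<^bsub>GL m\<^esub> (S \<otimes>\<^bsub>GL m\<^esub> shift m N p \<otimes>\<^bsub>GL m\<^esub> S)"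
    by (simp only: conj_a conj_p)
  also have "\<dots> = S \<otimes>\<^bsub>GL m\<^esub> (a \<otimes>\<^bsub>GL m\<^esub> shift m N p) \<otimes>\<^bsub>GL m\<^esub> S"
    by (simp add: GL.m_assoc Sc SSg ac shift_carrier pc)
  finally show ?thesis
    using dcoset_eq[OF GL.m_closed[OF ac shift_carrier[OF pc]] SP SP] by simp
qed

text \<open>Neither of \<open>N\<close> and \<open>N'\<close> need be twice the other, so both are
  compared with a third size that is large enough for each.\<close>

lemma dcoset_shift_indep:
  fixes a p :: "'k::field imat"
  assumes "a \<in> carrier (GL m)" "p \<in> carrier (GL m)"
    and "supported m N a" "supported m N p" "supported m N' a" "supported m N' p"
  shows "dcoset m (a \<otimes>\<^bsub>GL m\<^esub> shift m N p) = dcoset m (a \<otimes>\<^bsub>GL m\<^esub> shift m N' p)"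
  using dcoset_shift_large[OF assms(1-4), of "2 * N + 2 * N'"]
    dcoset_shift_large[OF assms(1,2,5,6), of "2 * N + 2 * N'"] by simp

text \<open>
  In \<open>x a y J z p w J\<close>, the shifted \<open>z\<close> is moved to the left across \<open>a y\<close> and then \<open>y\<close> to the
  right across the shifted \<open>p\<close>; both stay in \<open>P\<close> by conjugation.
\<close>

lemma dcoset_shift_representatives:
  fixes a p x y z w :: "'k::field imat"
  assumes ac: "a \<in> carrier (GL m)" and pc: "p \<in> carrier (GL m)"
    and P: "x \<in> P m" "y \<in> P m" "z \<in> P m" "w \<in> P m"
    and a: "supported m N a" and p: "supported m N p"
    and y: "supported m N y" and z: "supported m N z"
  shows "dcoset m ((x \<otimes>\<^bsub>GL m\<^esub> a \<otimes>\<^bsub>GL m\<^esub> y) \<otimes>\<^bsub>GL m\<^esub> shift m N (z \<otimes>\<^bsub>GL m\<^esub> p \<otimes>\<^bsub>GL m\<^esub> w))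
    = dcoset m (a \<otimes>\<^bsub>GL m\<^esub> shift m N p)"
proof -
  define q where "q = shift m N p"
  define b where "b = a \<otimes>\<^bsub>GL m\<^esub> y"
  define z' where "z' = b \<otimes>\<^bsub>GL m\<^esub> shift m N z \<otimes>\<^bsub>GL m\<^esub> inv\<^bsub>GL m\<^esub> b"
  define y' where "y' = inv\<^bsub>GL m\<^esub> q \<otimes>\<^bsub>GL m\<^esub> y \<otimes>\<^bsub>GL m\<^esub> q"
  note c = P[THEN P_carrier]
  have qc: "q \<in> carrier (GL m)" by (simp add: q_def shift_carrier pc)
  have bc: "b \<in> carrier (GL m)" by (simp add: b_def ac c)
  have z': "z' \<in> P m"
    unfolding z'_def by (rule conj_unshifted_in_P[OF bc P(3) _ z])
      (simp add: b_def GL_mult supported_mult a y)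
  \<comment> \<open>The inverse of \<open>p\<close> is used because moving \<open>y\<close> to the
    right across \<open>q\<close> requires q^-1 y q, not q y q^-1.\<close>
  have "shift m N (inv\<^bsub>GL m\<^esub> p) \<otimes>\<^bsub>GL m\<^esub> y \<otimes>\<^bsub>GL m\<^esub> inv\<^bsub>GL m\<^esub> (shift m N (inv\<^bsub>GL m\<^esub> p)) \<in> P m"
    by (rule conj_shift_in_P[OF GL.inv_closed[OF pc] P(2) supported_inv[OF pc p] y])
  then have y': "y' \<in> P m"
    using qc by (simp add: y'_def q_def shift_inv pc)
  have "z' \<otimes>\<^bsub>GL m\<^esub> b = b \<otimes>\<^bsub>GL m\<^esub> shift m N z"
    by (simp add: z'_def GL.m_assoc bc shift_carrier c)
  moreover have "q \<otimes>\<^bsub>GL m\<^esub> y' = y \<otimes>\<^bsub>GL m\<^esub> q"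
    by (simp add: y'_def GL.m_assoc[symmetric] qc c)
  ultimately have "b \<otimes>\<^bsub>GL m\<^esub> shift m N z \<otimes>\<^bsub>GL m\<^esub> q = z' \<otimes>\<^bsub>GL m\<^esub> (a \<otimes>\<^bsub>GL m\<^esub> q) \<otimes>\<^bsub>GL m\<^esub> y'"
    using P_carrier[OF z'] P_carrier[OF y'] by (metis b_def GL.m_assoc GL.m_closed ac c(2) qc)
  moreover have "(x \<otimes>\<^bsub>GL m\<^esub> a \<otimes>\<^bsub>GL m\<^esub> y) \<otimes>\<^bsub>GL m\<^esub> shift m N (z \<otimes>\<^bsub>GL m\<^esub> p \<otimes>\<^bsub>GL m\<^esub> w)
      = x \<otimes>\<^bsub>GL m\<^esub> (b \<otimes>\<^bsub>GL m\<^esub> shift m N z \<otimes>\<^bsub>GL m\<^esub> q) \<otimes>\<^bsub>GL m\<^esub> shift m N w"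
    by (simp add: b_def q_def shift_mult GL.m_assoc c ac pc shift_carrier)
  moreover have "a \<otimes>\<^bsub>GL m\<^esub> q \<in> carrier (GL m)"
    by (simp add: ac qc)
  ultimately show ?thesis
    using P_carrier[OF z'] P_carrier[OF y'] dcoset_eq[OF _ z' y'] dcoset_eq[OF _ P(1) shift_in_P[OF P(4)]]
    by (simp add: q_def)
qed

section \<open>Evaluation of the product and the involution\<close>

lemma star_dcoset:
  fixes a p :: "'k::field imat"
  assumes ac: "a \<in> carrier (GL m)" and pc: "p \<in> carrier (GL m)"
    and a: "supported m N a" and p: "supported m N p"
  shows "star m (dcoset m a) (dcoset m p) = dcoset m (a \<otimes>\<^bsub>GL m\<^esub> shift m N p)"
proof -
  have fold: "b \<otimes>\<^bsub>GL m\<^esub> J m M \<otimes>\<^bsub>GL m\<^esub> q \<otimes>\<^bsub>GL m\<^esub> J m M = b \<otimes>\<^bsub>GL m\<^esub> shift m M q"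
    if "b \<in> carrier (GL m)" "q \<in> carrier (GL m)" for b q :: "'k imat" and M
    using that by (simp add: shift_def GL.m_assoc J_carrier)
  show ?thesis
    unfolding star_def
  proof (rule the_equality)
    show "\<exists>b\<in>dcoset m a. \<exists>q\<in>dcoset m p. \<exists>M. supported m M b \<and> supported m M q \<and>
        dcoset m (a \<otimes>\<^bsub>GL m\<^esub> shift m N p)
          = dcoset m (b \<otimes>\<^bsub>GL m\<^esub> J m M \<otimes>\<^bsub>GL m\<^esub> q \<otimes>\<^bsub>GL m\<^esub> J m M)"
      using mem_dcoset_self[OF ac] mem_dcoset_self[OF pc] a p fold[OF ac pc, of N] by metis
  next
    fix D
    assume "\<exists>b\<in>dcoset m a. \<exists>q\<in>dcoset m p. \<exists>M. supported m M b \<and> supported m M q \<and>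
        D = dcoset m (b \<otimes>\<^bsub>GL m\<^esub> J m M \<otimes>\<^bsub>GL m\<^esub> q \<otimes>\<^bsub>GL m\<^esub> J m M)"
    then obtain b q M where b: "b \<in> dcoset m a" "supported m M b"
      and q: "q \<in> dcoset m p" "supported m M q"
      and D: "D = dcoset m (b \<otimes>\<^bsub>GL m\<^esub> J m M \<otimes>\<^bsub>GL m\<^esub> q \<otimes>\<^bsub>GL m\<^esub> J m M)"
      by blast
    obtain x y where xy: "x \<in> P m" "y \<in> P m" "b = x \<otimes>\<^bsub>GL m\<^esub> a \<otimes>\<^bsub>GL m\<^esub> y"
      using b(1) unfolding mem_dcoset_iff by blast
    obtain z w where zw: "z \<in> P m" "w \<in> P m" "q = z \<otimes>\<^bsub>GL m\<^esub> p \<otimes>\<^bsub>GL m\<^esub> w"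
      using q(1) unfolding mem_dcoset_iff by blast
    have bc: "b \<in> carrier (GL m)" and qc: "q \<in> carrier (GL m)"
      using xy zw by (simp_all add: P_carrier ac pc)
    obtain N1 where y: "supported m N1 y" using carrier_supported[OF P_carrier[OF xy(2)]] ..
    obtain N2 where z: "supported m N2 z" using carrier_supported[OF P_carrier[OF zw(1)]] ..
    \<comment> \<open>\<open>M\<close> bounds the products \<open>b\<close> and \<open>q\<close>,
      but not their factors \<open>y\<close> and \<open>z\<close>. Hence the size is raised to
      \<open>K\<close> with \<open>b\<close> and \<open>q\<close> kept, the representatives are
      exchanged at size \<open>K\<close>, and the size is lowered to \<open>N\<close> for
      \<open>a\<close> and \<open>p\<close>.\<close>
    define K where "K = N + M + N1 + N2"
    have le: "N \<le> K" "M \<le> K" "N1 \<le> K" "N2 \<le> K" by (simp_all add: K_def)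
    note s = supported_mono[OF a le(1)] supported_mono[OF p le(1)] supported_mono[OF y le(3)]
      supported_mono[OF z le(4)] supported_mono[OF b(2) le(2)] supported_mono[OF q(2) le(2)]
    have "D = dcoset m (b \<otimes>\<^bsub>GL m\<^esub> shift m M q)"
      using D fold[OF bc qc] by simp
    also have "\<dots> = dcoset m (b \<otimes>\<^bsub>GL m\<^esub> shift m K q)"
      by (rule dcoset_shift_indep[OF bc qc b(2) q(2) s(5,6)])
    also have "\<dots> = dcoset m (a \<otimes>\<^bsub>GL m\<^esub> shift m K p)"
      unfolding xy(3) zw(3)
      by (rule dcoset_shift_representatives[OF ac pc xy(1,2) zw(1,2) s(1-4)])
    also have "\<dots> = dcoset m (a \<otimes>\<^bsub>GL m\<^esub> shift m N p)"
      by (rule dcoset_shift_indep[OF ac pc s(1,2) a p])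
    finally show "D = dcoset m (a \<otimes>\<^bsub>GL m\<^esub> shift m N p)" .
  qed
qed

theorem proposition1p5:
  fixes m :: nat and \<aa> \<pp> :: "'k::field imat set"
  assumes "\<aa> \<in> double_cosets m" and "\<pp> \<in> double_cosets m"
  shows "involution m (star m \<aa> \<pp>) = star m (involution m \<pp>) (involution m \<aa>)"
proof -
  obtain a p where ac: "a \<in> carrier (GL m)" "\<aa> = dcoset m a"
    and pc: "p \<in> carrier (GL m)" "\<pp> = dcoset m p"
    using assms by (auto simp: double_cosets_def)
  obtain N1 N2 where N: "supported m N1 a" "supported m N2 p"
    using carrier_supported[OF ac(1)] carrier_supported[OF pc(1)] by (elim exE)
  define N where "N = N1 + N2"
  have a: "supported m N a" by (rule supported_mono[OF N(1)]) (simp add: N_def)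
  have p: "supported m N p" by (rule supported_mono[OF N(2)]) (simp add: N_def)
  \<comment> \<open>This represents the right-hand side; the inverse of the representative of the
    left-hand side is its shift.\<close>
  define g where "g = inv\<^bsub>GL m\<^esub> p \<otimes>\<^bsub>GL m\<^esub> shift m N (inv\<^bsub>GL m\<^esub> a)"
  have gc: "g \<in> carrier (GL m)"
    by (simp add: g_def shift_carrier ac pc)
  have "involution m (star m \<aa> \<pp>) = dcoset m (inv\<^bsub>GL m\<^esub> (a \<otimes>\<^bsub>GL m\<^esub> shift m N p))"
    by (simp add: ac pc star_dcoset[OF ac(1) pc(1) a p] involution_dcoset shift_carrier)
  also have "inv\<^bsub>GL m\<^esub> (a \<otimes>\<^bsub>GL m\<^esub> shift m N p) = shift m N g"
    by (simp add: g_def GL.inv_mult_group shift_mult shift_shift shift_inv shift_carrier ac pc)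
  also have "dcoset m (shift m N g) = dcoset m g"
    unfolding shift_def by (rule dcoset_eq[OF gc J_in_P J_in_P])
  also have "\<dots> = star m (involution m \<pp>) (involution m \<aa>)"
    unfolding g_def ac(2) pc(2) involution_dcoset[OF ac(1)] involution_dcoset[OF pc(1)]
    by (rule star_dcoset[symmetric, OF GL.inv_closed[OF pc(1)] GL.inv_closed[OF ac(1)]
          supported_inv[OF pc(1) p] supported_inv[OF ac(1) a]])
  finally show ?thesis .
qed

end
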